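(* Let $n \ge 1$. Among all trees on $n$ vertices, the star $S_n = K_{1,n-1}$ has the maximum weighted Szeged index; that is, for every tree $T$ on $n$ vertices, $wSz(T) \le wSz(S_n)$.
   Context: For a connected simple graph $G$ and an edge $e = uv \in E(G)$, let $n_u(e)$ denote the number of vertices $x \in V(G)$ with $d(x,u) < d(x,v)$, where $d$ is the shortest-path distance in $G$ (and similarly $n_v(e)$). The weighted Szeged index of $G$ is $$wSz(G) = \sum_{e = uv \in E(G)} \big(\deg(u) + \deg(v)\big)\, n_u(e)\, n_v(e),$$ where $\deg(u)$ is the degree of $u$. The star $S_n$ is the complete bipartite graph $K_{1,n-1}$. *)

theory Defs
  imports "Graph_Theory.Graph_Theory"
begin

text \<open>
  A finite simple graph is a symmetric digraph without loops and parallel arcs (locale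
  \<^locale>\<open>graph\<close>), so every edge \<open>uv\<close> is represented by the two arcs from \<open>u\<close> to \<open>v\<close> and from
  \<open>v\<close> to \<open>u\<close>.
\<close>

definition edges :: "('a,'b) pre_digraph \<Rightarrow> 'a set set" where
  "edges G = (\<lambda>a. {tail G a, head G a}) ` arcs G"

definition degree :: "('a,'b) pre_digraph \<Rightarrow> 'a \<Rightarrow> nat" where
  "degree G u = card {e \<in> edges G. u \<in> e}"

definition distance :: "('a,'b) pre_digraph \<Rightarrow> 'a \<Rightarrow> 'a \<Rightarrow> ereal" where
  "distance G = wf_digraph.\<mu> G (\<lambda>_. 1)"

text \<open>
  The library predicate \<^const>\<open>tree\<close> cannot be used here: it forbids directed cycles, and in a
  symmetric digraph the closed walk \<open>u, v, u\<close> along an edge \<open>uv\<close> is one. In a graph, the cycles of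
  length at least 3 are exactly the cycles of the undirected graph.
\<close>

definition undirected_tree :: "('a,'b) pre_digraph \<Rightarrow> bool" where
  "undirected_tree G \<longleftrightarrow>
     graph G \<and> connected G \<and> \<not> (\<exists>p. pre_digraph.cycle G p \<and> 3 \<le> length p)"

text \<open>
  For an edge \<open>e = uv\<close>, the only \<open>w \<in> e - {u}\<close> is \<open>v\<close>.
\<close>

definition closer_count :: "('a,'b) pre_digraph \<Rightarrow> 'a set \<Rightarrow> 'a \<Rightarrow> nat" where
  "closer_count G e u =
     card {x \<in> verts G. \<forall>w \<in> e - {u}. distance G x u < distance G x w}"

text \<open>
  For an edge \<open>e = uv\<close> the inner sum is \<open>deg(u) + deg(v)\<close> and the inner product is
  \<open>n_u(e) n_v(e)\<close>; each unordered edge is counted once.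
\<close>

definition weighted_Szeged :: "('a,'b) pre_digraph \<Rightarrow> nat" where
  "weighted_Szeged G =
     (\<Sum>e\<in>edges G. (\<Sum>u\<in>e. degree G u) * (\<Prod>u\<in>e. closer_count G e u))"

text \<open>
  The star on \<open>n\<close> vertices is \<^term>\<open>complete_bipartite_digraph 1 (n - 1)\<close>, a predicate that
  describes it up to isomorphism; it is satisfied for every \<open>n \<ge> 1\<close>.
\<close>

lemma star_exists:
  fixes n :: nat
  assumes "n \<ge> 1"
  shows "K\<^bsub>1,n - 1\<^esub> (with_proj
    \<lparr>pverts = {0..<n}, parcs = {0} \<times> {1..<n} \<union> {1..<n} \<times> {0}\<rparr>)"
  unfolding complete_bipartite_digraph_pair_def
proof (intro conjI exI)
  show "pverts \<lparr>pverts = {0..<n}, parcs = {0} \<times> {1..<n} \<union> {1..<n} \<times> {0}\<rparr> = {0} \<union> {1..<n}"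
    using assms by auto
qed simp_all

lemma weighted_Szeged_edge:
  assumes "graph G" and "a \<in> arcs G" and "u = tail G a" and "v = head G a"
  shows "(\<Sum>w\<in>{u, v}. degree G w) * (\<Prod>w\<in>{u, v}. closer_count G {u, v} w) =
    (degree G u + degree G v) *
    (card {x \<in> verts G. distance G x u < distance G x v} *
     card {x \<in> verts G. distance G x v < distance G x u})"
proof -
  interpret graph G by fact
  have "u \<noteq> v" using assms no_loops by auto
  moreover from this have "{u, v} - {u} = {v}" "{u, v} - {v} = {u}" by auto
  ultimately show ?thesis by (simp add: closer_count_def)
qed

end

theory Submission
  imports "HOL-Analysis.Convex" Defs
begin

text \<open>
  For adjacent \<open>u\<close> and \<open>v\<close> in a tree on \<open>n\<close> vertices let \<open>s(u,v)\<close> be the number of vertices closer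
  to \<open>v\<close> than to \<open>u\<close>, i.e. the size of the branch at \<open>u\<close> through \<open>v\<close>. Then \<open>s(u,v) + s(v,u) = n\<close>,
  and the branches at \<open>u\<close> partition the other vertices, so \<open>\<Sum>\<^sub>v s(u,v) = n - 1\<close>. Hence
  \<open>wSz = \<Sum>\<^sub>u deg u \<cdot> \<Sum>\<^sub>v s(u,v) (n - s(u,v)) = 2 n (n - 1)\<^sup>2 - \<Sum>\<^sub>u deg u \<cdot> \<Sum>\<^sub>v s(u,v)\<^sup>2\<close>, and by
  Cauchy-Schwarz each term \<open>deg u \<cdot> \<Sum>\<^sub>v s(u,v)\<^sup>2\<close> is at least \<open>(n - 1)\<^sup>2\<close>. So \<open>wSz \<le> n (n - 1)\<^sup>2\<close>,
  which is the value for the star.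
\<close>

section \<open>Neighbours, branches and the index as a sum over vertices\<close>

definition neighbours :: "('a,'b) pre_digraph \<Rightarrow> 'a \<Rightarrow> 'a set" where
  "neighbours G u = {v. u \<rightarrow>\<^bsub>G\<^esub> v}"

text \<open>The encoding by distance makes the size of \<open>branch G u v\<close> the factor
  \<open>n_v\<close> of the index outright. For an edge \<open>uv\<close> of a tree it is also the
  component of \<open>v\<close> after deletion of \<open>u\<close>.\<close>

definition branch :: "('a,'b) pre_digraph \<Rightarrow> 'a \<Rightarrow> 'a \<Rightarrow> 'a set" where
  "branch G u v = {x \<in> verts G. distance G x v < distance G x u}"

context graph
begin

lemma neighbours_subset: "neighbours G u \<subseteq> verts G"
  by (auto simp: neighbours_def adj_in_verts)

lemma finite_neighbours [simp]: "finite (neighbours G u)"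
  using neighbours_subset finite_verts by (rule finite_subset)

lemma finite_branch [simp]: "finite (branch G u v)"
  by (simp add: branch_def)

lemma neighbours_sym: "v \<in> neighbours G u \<longleftrightarrow> u \<in> neighbours G v"
  by (auto simp: neighbours_def intro: arcs_ends_symmetric[OF sym_arcs])

lemma neighbours_irrefl: "u \<notin> neighbours G u"
  by (auto simp: neighbours_def dest: adj_not_same)

lemma edges_conv: "edges G = {{u, v} | u v. u \<rightarrow> v}"
  by (auto simp: edges_def arcs_ends_conv)

text \<open>Double counting of incidences: an edge together with one of its ends \<open>u\<close>
  determines the other end \<open>v\<close>, so such pairs correspond to ordered pairs of adjacent
  vertices.\<close>

lemma sum_edges:
  "(\<Sum>e\<in>edges G. \<Sum>u\<in>e. f u e) = (\<Sum>u\<in>verts G. \<Sum>v\<in>neighbours G u. f u {u, v})"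
proof -
  have fin: "finite (edges G)" "\<And>e. e \<in> edges G \<Longrightarrow> finite e"
    by (auto simp: edges_def)
  let ?h = "\<lambda>(u, v). ({u, v}, u)"
  have bij: "bij_betw ?h (Sigma (verts G) (neighbours G)) (Sigma (edges G) (\<lambda>e. e))"
    unfolding bij_betw_def
  proof
    show "inj_on ?h (Sigma (verts G) (neighbours G))"
      by (auto simp: inj_on_def doubleton_eq_iff)
    show "?h ` Sigma (verts G) (neighbours G) = Sigma (edges G) (\<lambda>e. e)"
    proof (intro equalityI subsetI)
      fix z assume "z \<in> Sigma (edges G) (\<lambda>e. e)"
      then obtain e w where z: "z = (e, w)" "e \<in> edges G" "w \<in> e"
        by auto
      then obtain u v where uv: "e = {u, v}" "u \<rightarrow> v"
        by (auto simp: edges_conv)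
      have "v \<rightarrow> u" using uv(2) by (rule arcs_ends_symmetric[OF sym_arcs])
      show "z \<in> ?h ` Sigma (verts G) (neighbours G)"
      proof (cases "w = u")
        case True
        then have "z = ?h (u, v)" "(u, v) \<in> Sigma (verts G) (neighbours G)"
          using z uv by (auto simp: neighbours_def adj_in_verts)
        then show ?thesis by (rule image_eqI)
      next
        case False
        then have "z = ?h (v, u)" "(v, u) \<in> Sigma (verts G) (neighbours G)"
          using z uv \<open>v \<rightarrow> u\<close> by (auto simp: neighbours_def adj_in_verts)
        then show ?thesis by (rule image_eqI)
      qed
    qed (fastforce simp: edges_conv neighbours_def)
  qed
  have "(\<Sum>e\<in>edges G. \<Sum>u\<in>e. f u e) = (\<Sum>(e, u)\<in>Sigma (edges G) (\<lambda>e. e). f u e)"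
    using fin by (intro sum.Sigma) auto
  also have "\<dots> = (\<Sum>(u, v)\<in>Sigma (verts G) (neighbours G). f u {u, v})"
    by (subst sum.reindex_bij_betw[OF bij, symmetric]) (simp add: case_prod_unfold)
  also have "\<dots> = (\<Sum>u\<in>verts G. \<Sum>v\<in>neighbours G u. f u {u, v})"
    by (rule sum.Sigma[symmetric]) auto
  finally show ?thesis .
qed

lemma degree_eq_card_neighbours: "degree G u = card (neighbours G u)"
proof -
  have "{e \<in> edges G. u \<in> e} = (\<lambda>v. {u, v}) ` neighbours G u"
    by (auto simp: edges_conv neighbours_def insert_commute
        intro: arcs_ends_symmetric[OF sym_arcs])
  moreover have "inj_on (\<lambda>v. {u, v}) (neighbours G u)"
    by (auto simp: inj_on_def doubleton_eq_iff)
  ultimately show ?thesis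
    by (simp add: degree_def card_image)
qed

text \<open>The summands \<open>deg u\<close> and \<open>deg v\<close> of an edge are assigned to
  its two ordered pairs. This brings all branches at one vertex \<open>u\<close> together under the
  common factor \<open>degree G u\<close>.\<close>

lemma weighted_Szeged_conv:
  "weighted_Szeged G = (\<Sum>u\<in>verts G. degree G u *
     (\<Sum>v\<in>neighbours G u. card (branch G u v) * card (branch G v u)))"
proof -
  have "weighted_Szeged G =
      (\<Sum>e\<in>edges G. \<Sum>u\<in>e. degree G u * (\<Prod>w\<in>e. closer_count G e w))"
    by (simp add: weighted_Szeged_def sum_distrib_right)
  also have "\<dots> = (\<Sum>u\<in>verts G. \<Sum>v\<in>neighbours G u.
      degree G u * (\<Prod>w\<in>{u, v}. closer_count G {u, v} w))"
    by (rule sum_edges)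
  also have "\<dots> = (\<Sum>u\<in>verts G. \<Sum>v\<in>neighbours G u.
      degree G u * (card (branch G u v) * card (branch G v u)))"
  proof (intro sum.cong refl)
    fix u v assume "v \<in> neighbours G u"
    then have "u \<noteq> v" using neighbours_irrefl by auto
    then have "{u, v} - {u} = {v}" "{u, v} - {v} = {u}" by auto
    with \<open>u \<noteq> v\<close> show "degree G u * (\<Prod>w\<in>{u, v}. closer_count G {u, v} w) =
        degree G u * (card (branch G u v) * card (branch G v u))"
      by (simp add: closer_count_def branch_def)
  qed
  finally show ?thesis by (simp add: sum_distrib_left)
qed

section \<open>Shortest walks and walks that avoid a vertex\<close>

lemma distance_le_length:
  assumes "awalk u p v"
  shows "distance G u v \<le> ereal (length p)"
  using min_cost_le_walk_cost[OF assms, of "\<lambda>_. 1"]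
  by (simp add: distance_def awalk_cost_def sum_list_triv)

text \<open>The distance is an infimum in \<open>ereal\<close>; it is attained because walk lengths
  are natural numbers and some walk exists.\<close>

lemma shortest_walk_exists:
  assumes "u \<rightarrow>\<^sup>* v"
  obtains p where "awalk u p v" "distance G u v = ereal (length p)"
proof -
  obtain p where p: "awalk u p v" "\<And>q. awalk u q v \<Longrightarrow> length p \<le> length q"
    using assms ex_has_least_nat[of "\<lambda>p. awalk u p v" _ length]
    by (auto simp: reachable_awalk)
  have "ereal (length p) \<le> distance G u v"
    unfolding distance_def \<mu>_def
    using p(2) by (auto intro!: INF_greatest simp: awalk_cost_def sum_list_triv)
  with p(1) distance_le_length[OF p(1)] that show ?thesis
    by (metis antisym)
qed

lemma reachable_del_vertI:
  assumes "awalk u p w" "v \<notin> set (awalk_verts u p)"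
  shows "u \<rightarrow>\<^sup>*\<^bsub>del_vert v\<^esub> w"
  using assms
proof (induction p arbitrary: u)
  case Nil
  interpret D: wf_digraph "del_vert v" by (rule wf_digraph_del_vert)
  from Nil show ?case by (auto simp: awalk_Nil_iff del_vert_simps)
next
  case (Cons a p)
  interpret D: wf_digraph "del_vert v" by (rule wf_digraph_del_vert)
  have a: "a \<in> arcs G" "tail G a = u" "awalk (head G a) p w"
    and v: "v \<noteq> u" "v \<notin> set (awalk_verts (head G a) p)"
    using Cons.prems by (auto simp: awalk_Cons_iff)
  then have "head G a \<noteq> v"
    using hd_in_awalk_verts(1) by metis
  then have "u \<rightarrow>\<^bsub>del_vert v\<^esub> head G a"
    using a v by (auto simp: arcs_ends_conv del_vert_simps)
  then show ?case
    using Cons.IH[OF a(3) v(2)] by (rule D.adj_reachable_trans)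
qed

lemma reachable_del_vertE:
  assumes "u \<rightarrow>\<^sup>*\<^bsub>del_vert v\<^esub> w"
  obtains p where "apath u p w" "v \<notin> set (awalk_verts u p)"
proof -
  interpret D: wf_digraph "del_vert v" by (rule wf_digraph_del_vert)
  \<comment> \<open>Deleting a vertex leaves \<open>tail\<close> and \<open>head\<close> unchanged,
    so the walk functions of the two graphs coincide and the path can be transferred.\<close>
  have verts_eq: "D.awalk_verts a p = awalk_verts a p" for a p
    by (induction p arbitrary: a) (auto simp: del_vert_simps D.awalk_verts.simps)
  have cas_eq: "D.cas a p b = cas a p b" for a p b
    by (induction p arbitrary: a) (auto simp: del_vert_simps D.cas.simps)
  obtain p where p: "D.apath u p w"
    using assms D.reachable_apath by auto
  then have "apath u p w"
    by (auto simp: D.apath_def apath_def D.awalk_def awalk_def verts_eq cas_eq del_vert_simps)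
  moreover have "v \<notin> set (awalk_verts u p)"
    using p D.awalk_verts_in_verts[of u p v]
    by (auto simp: D.apath_def D.awalk_def verts_eq del_vert_simps)
  ultimately show ?thesis by (rule that)
qed

lemma symmetric_del_vert: "symmetric (del_vert v)"
  using sym_arcs by (fastforce simp: symmetric_conv del_vert_simps)

text \<open>A shortest walk from \<open>x\<close> to \<open>u\<close> misses \<open>v\<close>:
  otherwise its proper initial part up to \<open>v\<close> would make \<open>v\<close> strictly
  closer to \<open>x\<close> than \<open>u\<close>. The argument tolerates ties, which is what later
  rules them out in trees.\<close>

lemma reachable_del_vert_if_distance_le:
  assumes "x \<rightarrow>\<^sup>* u" "u \<noteq> v" "distance G x u \<le> distance G x v"
  shows "x \<rightarrow>\<^sup>*\<^bsub>del_vert v\<^esub> u"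
proof -
  obtain p where p: "awalk x p u" "distance G x u = ereal (length p)"
    using shortest_walk_exists[OF assms(1)] .
  have "v \<notin> set (awalk_verts x p)"
  proof
    assume "v \<in> set (awalk_verts x p)"
    then obtain q r where qr: "p = q @ r" "awalk x q v" "awalk v r u"
      using awalk_decomp[OF p(1)] by metis
    then have "r \<noteq> []" using assms(2) by (auto simp: awalk_Nil_iff)
    then have "ereal (length q) < distance G x u"
      using p qr by simp
    then show False
      using distance_le_length[OF qr(2)] assms(3) by simp
  qed
  with p(1) show ?thesis by (rule reachable_del_vertI)
qed

text \<open>The required neighbour is the last vertex before \<open>v\<close> on a shortest walk
  from \<open>x\<close>.\<close>

lemma closer_neighbour_exists:
  assumes "x \<rightarrow>\<^sup>* v" "x \<noteq> v"
  obtains u where "u \<in> neighbours G v" "distance G x u < distance G x v"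
proof -
  obtain p where p: "awalk x p v" "distance G x v = ereal (length p)"
    using shortest_walk_exists[OF assms(1)] .
  have "p \<noteq> []" using p(1) assms(2) by (auto simp: awalk_Nil_iff)
  then obtain q a where qa: "p = q @ [a]" by (metis rev_exhaust)
  then have a: "a \<in> arcs G" "head G a = v" "awalk x q (tail G a)"
    using p(1) by (auto simp: awalk_simps)
  have "tail G a \<in> neighbours G v"
    using a(1,2) arcs_ends_symmetric[OF sym_arcs, of "tail G a" v]
    by (auto simp: neighbours_def arcs_ends_conv)
  moreover have "distance G x (tail G a) < distance G x v"
    using distance_le_length[OF a(3)] p(2) qa
    by (auto elim: order.strict_trans1)
  ultimately show ?thesis by (rule that)
qed

end

section \<open>Distances and branches in a tree\<close>

lemma undirected_tree_graph: "undirected_tree G \<Longrightarrow> graph G"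
  by (simp add: undirected_tree_def)

lemma undirected_tree_reachable:
  assumes "undirected_tree G" "u \<in> verts G" "v \<in> verts G"
  shows "u \<rightarrow>\<^sup>*\<^bsub>G\<^esub> v"
proof -
  interpret graph G using assms(1) by (rule undirected_tree_graph)
  have "strongly_connected G"
    using assms(1) by (intro symmetric_connected_imp_strongly_connected sym_arcs)
      (simp add: undirected_tree_def)
  with assms(2,3) show ?thesis by (auto elim: strongly_connectedE)
qed

text \<open>A path between two distinct neighbours of \<open>v\<close> that avoids \<open>v\<close>
  closes up through \<open>v\<close> to a cycle. The path has at least one arc, so the cycle has
  length at least 3.\<close>

lemma undirected_tree_neighbours_separated:
  assumes tree: "undirected_tree G"
    and u: "u \<in> neighbours G v" and w: "w \<in> neighbours G v"
    and reach: "u \<rightarrow>\<^sup>*\<^bsub>pre_digraph.del_vert G v\<^esub> w"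
  shows "u = w"
proof (rule ccontr)
  assume "u \<noteq> w"
  interpret graph G using tree by (rule undirected_tree_graph)
  obtain p where p: "apath u p w" "v \<notin> set (awalk_verts u p)"
    using reachable_del_vertE[OF reach] .
  then have p': "awalk u p w" "distinct (awalk_verts u p)" "p \<noteq> []"
    using \<open>u \<noteq> w\<close> by (auto simp: apath_def awalk_Nil_iff)
  obtain a where a: "a \<in> arcs G" "tail G a = v" "head G a = u"
    using u by (auto simp: neighbours_def arcs_ends_conv)
  have "v \<in> neighbours G w" using w neighbours_sym by blast
  then obtain b where b: "b \<in> arcs G" "tail G b = w" "head G b = v"
    by (auto simp: neighbours_def arcs_ends_conv)
  have walk_b: "awalk w [b] v"
    using b by (auto simp: awalk_simps)
  then have pb: "awalk u (p @ [b]) v"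
    using p'(1) by (auto intro: awalk_appendI)
  have walk: "awalk v (a # p @ [b]) v"
    using a pb by (auto simp: awalk_Cons_iff)
  have "awalk_verts u (p @ [b]) = awalk_verts u p @ [v]"
    using awalk_verts_append[OF pb] awlast_of_awalk[OF p'(1)] b by simp
  then have "distinct (tl (awalk_verts v (a # p @ [b])))"
    using a p p' by simp
  with walk have "cycle (a # p @ [b])"
    by (auto simp: cycle_def)
  moreover have "3 \<le> length (a # p @ [b])"
    using \<open>p \<noteq> []\<close> by (cases p) auto
  ultimately show False
    using tree by (auto simp: undirected_tree_def)
qed

text \<open>Both neighbours are joined to \<open>x\<close> by walks avoiding \<open>v\<close>, so
  they lie in one component after deletion of \<open>v\<close>.\<close>

lemma undirected_tree_nearest_neighbour_unique:
  assumes tree: "undirected_tree G" and x: "x \<in> verts G"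
    and u: "u \<in> neighbours G v" "distance G x u \<le> distance G x v"
    and w: "w \<in> neighbours G v" "distance G x w \<le> distance G x v"
  shows "u = w"
proof -
  interpret graph G using tree by (rule undirected_tree_graph)
  interpret D: wf_digraph "del_vert v" by (rule wf_digraph_del_vert)
  have "x \<rightarrow>\<^sup>*\<^bsub>del_vert v\<^esub> u" "x \<rightarrow>\<^sup>*\<^bsub>del_vert v\<^esub> w"
    using u w x neighbours_irrefl neighbours_subset
    by (blast intro!: reachable_del_vert_if_distance_le undirected_tree_reachable[OF tree])+
  then have "u \<rightarrow>\<^sup>*\<^bsub>del_vert v\<^esub> w"
    using symmetric_reachable[OF symmetric_del_vert] D.reachable_trans by blast
  with tree u(1) w(1) show ?thesis by (rule undirected_tree_neighbours_separated)
qed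

text \<open>With a tie, one end \<open>z\<close> of the edge would have two neighbours no farther
  from \<open>x\<close> than \<open>z\<close>: the other end, and a strictly closer one. Uniqueness
  identifies them, which is absurd.\<close>

lemma undirected_tree_distance_neq:
  assumes tree: "undirected_tree G" and x: "x \<in> verts G" and u: "u \<in> neighbours G v"
  shows "distance G x u \<noteq> distance G x v"
proof
  assume eq: "distance G x u = distance G x v"
  interpret graph G using tree by (rule undirected_tree_graph)
  have uv: "u \<noteq> v" "u \<in> verts G" "v \<in> verts G"
    using u neighbours_irrefl neighbours_subset neighbours_sym by blast+
  \<comment> \<open>The tie is symmetric in \<open>u\<close> and \<open>v\<close>, so
    \<open>z\<close> may be chosen as an end different from \<open>x\<close>; only such an end has a
    neighbour closer to \<open>x\<close>.\<close>
  then obtain y z where yz: "{y, z} = {u, v}" "x \<noteq> z" "y \<in> neighbours G z"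
    using u neighbours_sym by (metis insert_commute)
  have "z \<in> verts G" using yz uv by auto
  then obtain w where w: "w \<in> neighbours G z" "distance G x w < distance G x z"
    using closer_neighbour_exists undirected_tree_reachable[OF tree x] yz(2) by metis
  have "distance G x y = distance G x z"
    using yz(1) eq by (auto simp: doubleton_eq_iff)
  then have "w = y"
    using undirected_tree_nearest_neighbour_unique[OF tree x w(1) _ yz(3)] w(2) by simp
  with w(2) \<open>distance G x y = distance G x z\<close> show False by simp
qed

lemma undirected_tree_card_branch_add:
  assumes tree: "undirected_tree G" and v: "v \<in> neighbours G u"
  shows "card (branch G u v) + card (branch G v u) = card (verts G)"
proof -
  interpret graph G using tree by (rule undirected_tree_graph)
  have "branch G u v \<union> branch G v u = verts G"
    using undirected_tree_distance_neq[OF tree _ v] by (fastforce simp: branch_def neq_iff)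
  moreover have "branch G u v \<inter> branch G v u = {}"
    by (auto simp: branch_def)
  ultimately show ?thesis
    by (metis card_Un_disjoint finite_branch)
qed

text \<open>A closer neighbour of \<open>u\<close> exists for each vertex other than
  \<open>u\<close>, so the branches cover these vertices; its uniqueness makes the branches
  disjoint.\<close>

lemma undirected_tree_sum_card_branch:
  assumes tree: "undirected_tree G" and u: "u \<in> verts G"
  shows "(\<Sum>v\<in>neighbours G u. card (branch G u v)) = card (verts G) - 1"
proof -
  interpret graph G using tree by (rule undirected_tree_graph)
  have "u \<notin> branch G u v" for v
  proof
    assume "u \<in> branch G u v"
    then have "distance G u v < distance G u u" by (simp add: branch_def)
    also have "\<dots> \<le> 0"
      using distance_le_length[of u "[]" u] u by (simp add: awalk_Nil_iff zero_ereal_def)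
    also have "0 \<le> distance G u v"
      unfolding distance_def \<mu>_def
      by (auto intro!: INF_greatest simp: awalk_cost_def sum_list_triv)
    finally show False by simp
  qed
  then have "(\<Union>v\<in>neighbours G u. branch G u v) \<subseteq> verts G - {u}"
    by (auto simp: branch_def)
  moreover have "x \<in> (\<Union>v\<in>neighbours G u. branch G u v)" if x: "x \<in> verts G - {u}" for x
  proof -
    obtain v where "v \<in> neighbours G u" "distance G x v < distance G x u"
      using closer_neighbour_exists undirected_tree_reachable[OF tree _ u] x by blast
    with x show ?thesis by (auto simp: branch_def)
  qed
  ultimately have "(\<Union>v\<in>neighbours G u. branch G u v) = verts G - {u}"
    by blast
  moreover have "branch G u v \<inter> branch G u w = {}"
    if "v \<in> neighbours G u" "w \<in> neighbours G u" "v \<noteq> w" for v w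
    using undirected_tree_nearest_neighbour_unique[OF tree _ that(1) _ that(2)] that(3)
    by (fastforce simp: branch_def)
  then have "card (\<Union>v\<in>neighbours G u. branch G u v) =
      (\<Sum>v\<in>neighbours G u. card (branch G u v))"
    by (intro card_UN_disjoint) auto
  ultimately show ?thesis using u by simp
qed

section \<open>The degree sum and the upper bound\<close>

text \<open>This is the edge count of a tree, obtained without induction: summing
  \<open>s(u,v) + s(v,u) = n\<close> over ordered adjacent pairs gives \<open>n\<close> times the
  degree sum, while summing the branches vertex by vertex gives \<open>2 n (n - 1)\<close>.\<close>

lemma undirected_tree_sum_degree:
  assumes tree: "undirected_tree G"
  shows "(\<Sum>u\<in>verts G. degree G u) = 2 * (card (verts G) - 1)"
proof -
  interpret graph G using tree by (rule undirected_tree_graph)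
  let ?n = "card (verts G)"
  let ?s = "\<lambda>u v. card (branch G u v)"
  have "(\<Sum>u\<in>verts G. \<Sum>v\<in>neighbours G u. ?s v u) =
      (\<Sum>(u, v)\<in>Sigma (verts G) (neighbours G). ?s v u)"
    by (rule sum.Sigma) auto
  also have "\<dots> = (\<Sum>(u, v)\<in>Sigma (verts G) (neighbours G). ?s u v)"
    by (rule sum.reindex_bij_witness[of _ prod.swap prod.swap])
      (use neighbours_sym neighbours_subset in \<open>auto, blast+\<close>)
  also have "\<dots> = (\<Sum>u\<in>verts G. \<Sum>v\<in>neighbours G u. ?s u v)"
    by (rule sum.Sigma[symmetric]) auto
  finally have swap: "(\<Sum>u\<in>verts G. \<Sum>v\<in>neighbours G u. ?s v u) =
      (\<Sum>u\<in>verts G. \<Sum>v\<in>neighbours G u. ?s u v)" .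
  have "?n * (\<Sum>u\<in>verts G. degree G u) = (\<Sum>u\<in>verts G. \<Sum>v\<in>neighbours G u. ?n)"
    by (simp add: degree_eq_card_neighbours sum_distrib_left mult.commute)
  also have "\<dots> = (\<Sum>u\<in>verts G. \<Sum>v\<in>neighbours G u. ?s u v + ?s v u)"
    by (intro sum.cong refl) (simp add: undirected_tree_card_branch_add[OF tree])
  also have "\<dots> = 2 * (\<Sum>u\<in>verts G. \<Sum>v\<in>neighbours G u. ?s u v)"
    using swap by (simp add: sum.distrib)
  also have "\<dots> = ?n * (2 * (?n - 1))"
    by (simp add: undirected_tree_sum_card_branch[OF tree])
  \<comment> \<open>Cancelling \<open>?n\<close> needs a vertex; without one both sides are 0 by
    truncated subtraction.\<close>
  finally show ?thesis
    using finite_verts by (cases "verts G = {}") auto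
qed

lemma weighted_Szeged_tree_le:
  assumes tree: "undirected_tree G"
  shows "weighted_Szeged G \<le> card (verts G) * (card (verts G) - 1)\<^sup>2"
proof -
  interpret graph G using tree by (rule undirected_tree_graph)
  let ?n = "card (verts G)"
  let ?s = "\<lambda>u v. card (branch G u v)"
  let ?D = "\<Sum>u\<in>verts G. degree G u * (\<Sum>v\<in>neighbours G u. (?s u v)\<^sup>2)"
  have "(?n - 1)\<^sup>2 \<le> degree G u * (\<Sum>v\<in>neighbours G u. (?s u v)\<^sup>2)" if "u \<in> verts G" for u
  proof -
    \<comment> \<open>Cauchy-Schwarz against the constant 1 on the neighbours, stated over the reals
      and then pulled back to \<open>nat\<close>.\<close>
    have "(\<Sum>v\<in>neighbours G u. real (?s u v))\<^sup>2 \<le>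
        (\<Sum>v\<in>neighbours G u. (real (?s u v))\<^sup>2) * card (neighbours G u)"
      by (rule sum_squared_le_sum_of_squares)
    then have "real ((\<Sum>v\<in>neighbours G u. ?s u v)\<^sup>2) \<le>
        real (card (neighbours G u) * (\<Sum>v\<in>neighbours G u. (?s u v)\<^sup>2))"
      by (simp add: mult.commute)
    then show ?thesis
      unfolding of_nat_le_iff
      by (simp add: undirected_tree_sum_card_branch[OF tree that] degree_eq_card_neighbours)
  qed
  then have D: "?n * (?n - 1)\<^sup>2 \<le> ?D"
    using sum_mono[of "verts G" "\<lambda>_. (?n - 1)\<^sup>2"] by simp
  \<comment> \<open>Adding \<open>?D\<close> avoids subtraction on \<open>nat\<close>: each product
    and square combine to \<open>s(u,v) (s(u,v) + s(v,u))\<close>, whose second factor is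
    \<open>?n\<close>.\<close>
  have "weighted_Szeged G + ?D = (\<Sum>u\<in>verts G. degree G u *
      (\<Sum>v\<in>neighbours G u. ?s u v * (?s u v + ?s v u)))"
    by (simp add: weighted_Szeged_conv sum.distrib algebra_simps power2_eq_square)
  also have "\<dots> = (\<Sum>u\<in>verts G. degree G u * (\<Sum>v\<in>neighbours G u. ?s u v * ?n))"
    by (intro sum.cong refl arg_cong2[where f = times])
      (simp add: undirected_tree_card_branch_add[OF tree])
  also have "\<dots> = (\<Sum>u\<in>verts G. degree G u * ((?n - 1) * ?n))"
    by (intro sum.cong refl)
      (simp add: undirected_tree_sum_card_branch[OF tree] flip: sum_distrib_right)
  also have "\<dots> = 2 * (?n * (?n - 1)\<^sup>2)"
    by (simp add: undirected_tree_sum_degree[OF tree] power2_eq_square flip: sum_distrib_right)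
  finally show ?thesis using D by linarith
qed

section \<open>The star\<close>

text \<open>Every arc has exactly one end at \<open>c\<close>, so walks alternate between
  \<open>c\<close> and leaves. A closed walk with at least 3 arcs then visits \<open>c\<close> twice
  after its start, so it is no cycle.\<close>

lemma star_undirected_tree:
  assumes G: "graph G" and V: "verts G = insert c L" "c \<notin> L"
    and E: "arcs_ends G = {c} \<times> L \<union> L \<times> {c}"
  shows "undirected_tree G"
proof -
  interpret graph G by fact
  have arc: "tail G a = c \<longleftrightarrow> head G a \<noteq> c" if "a \<in> arcs G" for a
  proof -
    have "(tail G a, head G a) \<in> {c} \<times> L \<union> L \<times> {c}"
      using that E by (auto simp: arcs_ends_conv)
    then show ?thesis using V(2) by auto
  qed
  have to_c: "u \<rightarrow>\<^sup>*\<^bsub>G\<^esub> c" if "u \<in> verts G" for u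
    using that V E by (cases "u = c") auto
  have "u \<rightarrow>\<^sup>*\<^bsub>G\<^esub> v" if "u \<in> verts G" "v \<in> verts G" for u v
    using that to_c symmetric_reachable' reachable_trans by blast
  then have "strongly_connected (mk_symmetric G)"
    using V(1) by (auto simp: strongly_connected_def reachable_mk_symmetric_eq[OF sym_arcs])
  then have "connected G" by (simp add: connected_def)
  moreover have "\<not> (cycle p \<and> 3 \<le> length p)" for p
  proof
    assume "cycle p \<and> 3 \<le> length p"
    then obtain u where u: "awalk u p u" "distinct (tl (awalk_verts u p))" and "3 \<le> length p"
      by (auto simp: cycle_def)
    then obtain a1 a2 a3 q where p: "p = a1 # a2 # a3 # q"
      by (auto simp: numeral_3_eq_3 Suc_le_length_iff)
    have arcs: "a1 \<in> arcs G" "a2 \<in> arcs G" "a3 \<in> arcs G"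
      and ends: "tail G a1 = u" "tail G a2 = head G a1" "tail G a3 = head G a2"
      and q: "awalk (head G a3) q u"
      using u(1) by (auto simp: p awalk_Cons_iff)
    have dist: "distinct (head G a1 # head G a2 # awalk_verts (head G a3) q)"
      using u(2) ends by (simp add: p)
    show False
    proof (cases "u = c")
      case True
      then have "c = head G a2" "head G a3 \<noteq> c"
        using arc[OF arcs(1)] arc[OF arcs(2)] arc[OF arcs(3)] ends by auto
      \<comment> \<open>The walk ends at its start \<open>c\<close>, which is a second visit after
        \<open>head G a2\<close>.\<close>
      moreover have "u \<in> set (awalk_verts (head G a3) q)"
        using q by (metis awalkE awalk_verts_non_Nil last_in_set)
      ultimately show False using dist True by simp
    next
      case False
      then have "head G a1 = c" "head G a3 = c"
        using arc[OF arcs(1)] arc[OF arcs(2)] arc[OF arcs(3)] ends by auto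
      moreover have "head G a3 \<in> set (awalk_verts (head G a3) q)"
        using q by (rule hd_in_awalk_verts)
      ultimately show False using dist by simp
    qed
  qed
  ultimately show ?thesis using G by (auto simp: undirected_tree_def)
qed

text \<open>No distance is computed: a leaf has a single branch, whose size \<open>card L\<close>
  follows from the branch sum, and the opposite branch then has size 1.\<close>

lemma weighted_Szeged_star:
  assumes G: "graph G" and V: "verts G = insert c L" "c \<notin> L"
    and E: "arcs_ends G = {c} \<times> L \<union> L \<times> {c}"
  shows "weighted_Szeged G = card (verts G) * (card (verts G) - 1)\<^sup>2"
proof -
  interpret graph G by fact
  have tree: "undirected_tree G" using assms by (rule star_undirected_tree)
  have fin: "finite L" using V finite_verts by auto
  have nc: "neighbours G c = L"
    using V E by (auto simp: neighbours_def)
  have nl: "neighbours G l = {c}" if "l \<in> L" for l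
    using that V E by (auto simp: neighbours_def)
  have n: "card (verts G) = Suc (card L)"
    using V fin by simp
  have lc: "card (branch G l c) = card L" if "l \<in> L" for l
    using undirected_tree_sum_card_branch[OF tree, of l] that V n by (simp add: nl)
  have cl: "card (branch G c l) = 1" if "l \<in> L" for l
    using undirected_tree_card_branch_add[OF tree, of l c] that n by (simp add: nc lc)
  show ?thesis
    using V fin
    by (simp add: weighted_Szeged_conv degree_eq_card_neighbours nc nl lc cl n
        power2_eq_square)
qed

theorem theorem1:
  fixes n :: nat and S :: "('a,'b) pre_digraph"
  assumes "n \<ge> 1" and "K\<^bsub>1,n - 1\<^esub> S"
  shows "undirected_tree S \<and> card (verts S) = n \<and>
    (\<forall>T :: ('c,'d) pre_digraph.
       undirected_tree T \<and> card (verts T) = n \<longrightarrow> weighted_Szeged T \<le> weighted_Szeged S)"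
proof -
  obtain U L where S: "graph S" "verts S = U \<union> L" "U \<inter> L = {}" "card U = 1" "card L = n - 1"
      "arcs_ends S = U \<times> L \<union> L \<times> U"
    using assms(2) unfolding complete_bipartite_digraph_def by blast
  then obtain c where c: "U = {c}" by (metis card_1_singletonE)
  have star: "verts S = insert c L" "c \<notin> L" "arcs_ends S = {c} \<times> L \<union> L \<times> {c}"
    using S c by auto
  interpret graph S by fact
  \<comment> \<open>For \<open>n = 1\<close> the equation \<open>card L = n - 1\<close> alone would
    also admit an infinite \<open>L\<close>.\<close>
  have "finite L"
    using finite_verts S(2) by simp
  then have n: "card (verts S) = n"
    using star S(5) assms(1) by simp
  show ?thesis
    using star_undirected_tree[OF S(1) star] weighted_Szeged_star[OF S(1) star] n
      weighted_Szeged_tree_le by metis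
qed

end
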